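(* The class of languages accepted by deterministic register set automata is closed under union, intersection, and complement.
   Context: Fix a finite nonempty alphabet $\Sigma$ and an infinite data domain $\mathbb{D}$. A register set automaton (RsA) is a tuple $(Q,R,\Delta,I,F)$ with $Q$ finite states, $R$ finite registers, $I,F\subseteq Q$, and transitions $q\xrightarrow{a\mid G^{\in},G^{\notin},up}s$ with $a\in\Sigma$, $G^{\in},G^{\notin}\subseteq R$ disjoint, $up\colon R\to 2^{R\cup\{\mathit{in}\}}$. Configurations are $(q,f)$ with $f\colon R\to 2^{\mathbb{D}}$; initial ones have $q\in I$ and all registers empty. A step over $(a,d)$ is possible iff $d\in f(r)$ for all $r\in G^{\in}$ and $d\notin f(r)$ for all $r\in G^{\notin}$; afterwards each register $r$ holds $\bigcup\{f(r')\mid r'\in R\cap up(r)\}$, plus $d$ if $\mathit{in}\in up(r)$. $L(\mathcal{A})\subseteq(\Sigma\times\mathbb{D})^*$ is the set of words with a run from an initial configuration ending in $F$. An RsA is deterministic (DRsA) if for every $q\in Q$, $a\in\Sigma$ and any two distinct transitions $q\xrightarrow{a\mid G^{\in}_1,G^{\notin}_1,up_1}s_1$, $q\xrightarrow{a\mid G^{\in}_2,G^{\notin}_2,up_2}s_2$ in $\Delta$, we have $G^{\in}_1\cap G^{\notin}_2\neq\emptyset$ or $G^{\in}_2\cap G^{\notin}_1\neq\emptyset$. Complement is with respect to $(\Sigma\times\mathbb{D})^*$. *)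

theory Defs
  imports Main "HOL-Library.FuncSet"
begin

datatype 'r source = Reg 'r | In

record ('q, 'r, 'a) transition =
  src   :: 'q
  lab   :: 'a
  gin   :: "'r set"
  gnin  :: "'r set"
  upd   :: "'r \<Rightarrow> 'r source set"
  tgt   :: 'q

record ('q, 'r, 'a) rsa =
  states :: "'q set"
  regs   :: "'r set"
  trans  :: "('q, 'r, 'a) transition set"
  init   :: "'q set"
  final  :: "'q set"

text \<open>The update function is required to be extensional (undefined outside the registers), so that
  equality of transitions, on which determinism depends, is equality of functions on the
  registers. The alphabet is the whole type \<open>'a\<close>.\<close>

definition is_transition :: "('q, 'r, 'a) rsa \<Rightarrow> ('q, 'r, 'a) transition \<Rightarrow> bool" where
  "is_transition A t \<longleftrightarrow>
     src t \<in> states A \<and> tgt t \<in> states A \<and>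
     gin t \<subseteq> regs A \<and> gnin t \<subseteq> regs A \<and> gin t \<inter> gnin t = {} \<and>
     upd t \<in> regs A \<rightarrow>\<^sub>E Pow (insert In (Reg ` regs A))"

definition is_rsa :: "('q, 'r, 'a) rsa \<Rightarrow> bool" where
  "is_rsa A \<longleftrightarrow>
     finite (states A) \<and> finite (regs A) \<and>
     (\<forall>t\<in>trans A. is_transition A t) \<and>
     init A \<subseteq> states A \<and> final A \<subseteq> states A"

text \<open>The set of initial states is not required to be a singleton.\<close>

definition deterministic :: "('q, 'r, 'a) rsa \<Rightarrow> bool" where
  "deterministic A \<longleftrightarrow>
     (\<forall>q\<in>states A. \<forall>a. \<forall>t1\<in>trans A. \<forall>t2\<in>trans A.
        src t1 = q \<and> lab t1 = a \<and> src t2 = q \<and> lab t2 = a \<and> t1 \<noteq> t2 \<longrightarrow>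
        gin t1 \<inter> gnin t2 \<noteq> {} \<or> gin t2 \<inter> gnin t1 \<noteq> {})"

type_synonym ('q, 'r, 'd) config = "'q \<times> ('r \<Rightarrow> 'd set)"

definition initial_config :: "('q, 'r, 'a) rsa \<Rightarrow> ('q, 'r, 'd) config \<Rightarrow> bool" where
  "initial_config A c \<longleftrightarrow> (\<exists>q\<in>init A. c = (q, \<lambda>r\<in>regs A. {}))"

definition enabled :: "('q, 'r, 'a) transition \<Rightarrow> ('r \<Rightarrow> 'd set) \<Rightarrow> 'd \<Rightarrow> bool" where
  "enabled t f d \<longleftrightarrow> (\<forall>r\<in>gin t. d \<in> f r) \<and> (\<forall>r\<in>gnin t. d \<notin> f r)"

definition update ::
  "('q, 'r, 'a) rsa \<Rightarrow> ('q, 'r, 'a) transition \<Rightarrow> ('r \<Rightarrow> 'd set) \<Rightarrow> 'd \<Rightarrow> 'r \<Rightarrow> 'd set" where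
  "update A t f d =
     (\<lambda>r\<in>regs A. \<Union>{f r' | r'. r' \<in> regs A \<and> Reg r' \<in> upd t r} \<union> (if In \<in> upd t r then {d} else {}))"

definition step ::
  "('q, 'r, 'a) rsa \<Rightarrow> 'a \<times> 'd \<Rightarrow> ('q, 'r, 'd) config \<Rightarrow> ('q, 'r, 'd) config \<Rightarrow> bool" where
  "step A = (\<lambda>(a, d) (q, f) (q', f').
     \<exists>t\<in>trans A. src t = q \<and> lab t = a \<and> tgt t = q' \<and> enabled t f d \<and> f' = update A t f d)"

inductive run ::
  "('q, 'r, 'a) rsa \<Rightarrow> ('q, 'r, 'd) config \<Rightarrow> ('a \<times> 'd) list \<Rightarrow> ('q, 'r, 'd) config \<Rightarrow> bool"
  for A where
  run_Nil: "run A c [] c"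
| run_Cons: "step A x c c' \<Longrightarrow> run A c' w c'' \<Longrightarrow> run A c (x # w) c''"

definition language :: "('q, 'r, 'a) rsa \<Rightarrow> ('a \<times> 'd) list set" where
  "language A = {w. \<exists>c q f. initial_config A c \<and> run A c w (q, f) \<and> q \<in> final A}"

text \<open>States and registers are finite sets, so up to renaming they may be taken from the natural
  numbers; this is needed because a definition cannot quantify over types.\<close>

definition drsa_languages :: "('a \<times> 'd) list set set" where
  "drsa_languages = {language A | A :: (nat, nat, 'a) rsa. is_rsa A \<and> deterministic A}"

end

theory Submission imports Defs "HOL-Library.Nat_Bijection" begin

text \<open>A transition function that reads off the exact set \<open>G\<close> of registers containing the current data
  value is total and deterministic by construction. Languages of such machines are closed under
  complement (swap acceptance) and union (run two machines side by side on disjoint registers).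
  A machine is turned into an automaton by testing every register positively or negatively.
  Conversely, for a deterministic automaton at most one transition is compatible with a given \<open>G\<close>;
  adding a sink makes it a machine for each single initial state, and since there may be several
  initial states the language is the finite union over them.\<close>

section \<open>Machines driven by the set of registers that contain the datum\<close>

record ('q, 'r, 'a) machine =
  mstates :: "'q set"
  mregs :: "'r set"
  mstart :: 'q
  macc :: "'q set"
  mnext :: "'q \<Rightarrow> 'a \<Rightarrow> 'r set \<Rightarrow> 'q"
  mupd :: "'q \<Rightarrow> 'a \<Rightarrow> 'r set \<Rightarrow> 'r \<Rightarrow> 'r source set"

text \<open>\<open>mstep\<close> supplies only subsets of \<open>mregs M\<close>, so closure is
  asked for those alone. \<open>macc\<close> is left unconstrained, so that acceptance can be
  complemented in the whole type.\<close>

definition is_machine :: "('q, 'r, 'a) machine \<Rightarrow> bool" where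
  "is_machine M \<longleftrightarrow> finite (mstates M) \<and> finite (mregs M) \<and> mstart M \<in> mstates M \<and>
     (\<forall>q\<in>mstates M. \<forall>a. \<forall>G\<subseteq>mregs M. mnext M q a G \<in> mstates M \<and>
        (\<forall>r\<in>mregs M. mupd M q a G r \<subseteq> insert In (Reg ` mregs M)))"

definition mstep :: "('q, 'r, 'a) machine \<Rightarrow> ('q, 'r, 'd) config \<Rightarrow> 'a \<times> 'd \<Rightarrow> ('q, 'r, 'd) config" where
  "mstep M = (\<lambda>(q, f) (a, d). let G = {r \<in> mregs M. d \<in> f r} in
     (mnext M q a G,
      \<lambda>r\<in>mregs M. \<Union>{f r' | r'. r' \<in> mregs M \<and> Reg r' \<in> mupd M q a G r} \<union>
        (if In \<in> mupd M q a G r then {d} else {})))"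

definition mrun :: "('q, 'r, 'a) machine \<Rightarrow> ('a \<times> 'd) list \<Rightarrow> ('q, 'r, 'd) config" where
  "mrun M w = foldl (mstep M) (mstart M, \<lambda>r\<in>mregs M. {}) w"

definition machine_language :: "('q, 'r, 'a) machine \<Rightarrow> ('a \<times> 'd) list set" where
  "machine_language M = {w. fst (mrun M w) \<in> macc M}"

definition machine_languages :: "('a \<times> 'd) list set set" where
  "machine_languages = {machine_language M | M :: (nat, nat, 'a) machine. is_machine M}"

lemma mstep_in_states:
  assumes "is_machine M" "fst c \<in> mstates M"
  shows "fst (mstep M c x) \<in> mstates M"
  using assms by (cases c; cases x) (auto simp: mstep_def is_machine_def Let_def)

lemma run_Nil_iff: "run A c [] c' \<longleftrightarrow> c' = c"
  by (subst run.simps) auto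

lemma run_Cons_iff: "run A c (x # w) c'' \<longleftrightarrow> (\<exists>c'. step A x c c' \<and> run A c' w c'')"
  by (subst run.simps) auto

section \<open>The empty language and complements\<close>

text \<open>Base case for finite unions; it accounts for automata without initial states.\<close>

lemma machine_languages_empty: "{} \<in> machine_languages"
proof -
  let ?M = "\<lparr>mstates = {0}, mregs = {}, mstart = 0, macc = {}, mnext = \<lambda>_ _ _. 0,
    mupd = \<lambda>_ _ _ _. {}\<rparr> :: (nat, nat, 'a) machine"
  have "is_machine ?M" and "machine_language ?M = {}"
    by (auto simp: is_machine_def machine_language_def)
  then show ?thesis unfolding machine_languages_def by blast
qed

text \<open>Every word has exactly one run, and \<open>mstep\<close> never looks at
  \<open>macc\<close>, so swapping acceptance complements the language.\<close>

lemma machine_languages_Compl: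
  fixes L :: "('a \<times> 'd) list set"
  assumes "L \<in> machine_languages"
  shows "- L \<in> machine_languages"
proof -
  obtain M :: "(nat, nat, 'a) machine" where M: "is_machine M" "L = machine_language M"
    using assms unfolding machine_languages_def by blast
  let ?M = "M\<lparr>macc := - macc M\<rparr>"
  have "mstep ?M c x = mstep M c x" for c :: "(nat, nat, 'd) config" and x
    by (simp add: mstep_def)
  then have "mstep ?M = (mstep M :: (nat, nat, 'd) config \<Rightarrow> _)" by blast
  then have "machine_language ?M = - L"
    by (auto simp: M machine_language_def mrun_def)
  moreover have "is_machine ?M" using M by (simp add: is_machine_def)
  ultimately show ?thesis unfolding machine_languages_def by blast
qed

section \<open>Product machine and unions\<close>

abbreviation inl :: "nat \<Rightarrow> nat" where "inl r \<equiv> sum_encode (Inl r)"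
abbreviation inr :: "nat \<Rightarrow> nat" where "inr r \<equiv> sum_encode (Inr r)"

text \<open>States and registers must remain natural numbers, hence the encoded pairs and tagged
  sums. Each component is shown its own part of \<open>G\<close>, and its update sources are renamed
  by its own tag; \<open>In\<close> stays fixed because both components read the same datum.\<close>

definition union_machine ::
  "(nat, nat, 'a) machine \<Rightarrow> (nat, nat, 'a) machine \<Rightarrow> (nat, nat, 'a) machine" where
  "union_machine M N = \<lparr>
     mstates = prod_encode ` (mstates M \<times> mstates N),
     mregs = sum_encode ` (mregs M <+> mregs N),
     mstart = prod_encode (mstart M, mstart N),
     macc = {n. case prod_decode n of (p, q) \<Rightarrow> p \<in> macc M \<or> q \<in> macc N},
     mnext = \<lambda>n a G. case prod_decode n of (p, q) \<Rightarrow>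
       prod_encode (mnext M p a {r \<in> mregs M. inl r \<in> G}, mnext N q a {r \<in> mregs N. inr r \<in> G}),
     mupd = \<lambda>n a G k. case prod_decode n of (p, q) \<Rightarrow> (case sum_decode k of
         Inl r \<Rightarrow> map_source inl ` mupd M p a {r \<in> mregs M. inl r \<in> G} r
       | Inr r \<Rightarrow> map_source inr ` mupd N q a {r \<in> mregs N. inr r \<in> G} r)\<rparr>"

text \<open>Renaming sends \<open>In\<close> to \<open>In\<close> and a register source to a
  register source, so a case distinction on the preimage decides membership.\<close>

lemma map_source_mem [simp]:
  "In \<in> map_source h ` U \<longleftrightarrow> In \<in> U"
  "Reg k \<in> map_source h ` U \<longleftrightarrow> (\<exists>r. k = h r \<and> Reg r \<in> U)"
proof -
  have "x = In" if "In = map_source h x" for x :: "'b source" using that by (cases x) auto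
  then show "In \<in> map_source h ` U \<longleftrightarrow> In \<in> U" by (force simp: image_iff)
  have "\<exists>r. k = h r \<and> x = Reg r" if "Reg k = map_source h x" for x
    using that by (cases x) auto
  then show "Reg k \<in> map_source h ` U \<longleftrightarrow> (\<exists>r. k = h r \<and> Reg r \<in> U)"
    by (force simp: image_iff)
qed

lemma map_source_image_subset:
  assumes "U \<subseteq> insert In (Reg ` R)" and "h ` R \<subseteq> S"
  shows "map_source h ` U \<subseteq> insert In (Reg ` S)"
  using assms by fastforce

lemma is_machine_union_machine:
  assumes M: "is_machine M" and N: "is_machine N"
  shows "is_machine (union_machine M N)"
proof -
  let ?U = "union_machine M N"
  \<comment> \<open>The comprehension lies within the registers whatever \<open>P\<close> is, so the
    closure condition applies for every \<open>G\<close>.\<close>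
  have M': "mnext M p a {r \<in> mregs M. P r} \<in> mstates M"
    "r \<in> mregs M \<Longrightarrow> mupd M p a {r \<in> mregs M. P r} r \<subseteq> insert In (Reg ` mregs M)"
    if "p \<in> mstates M" for p a P r
    using that M by (simp_all add: is_machine_def)
  have N': "mnext N p a {r \<in> mregs N. P r} \<in> mstates N"
    "r \<in> mregs N \<Longrightarrow> mupd N p a {r \<in> mregs N. P r} r \<subseteq> insert In (Reg ` mregs N)"
    if "p \<in> mstates N" for p a P r
    using that N by (simp_all add: is_machine_def)
  have regs: "inl ` mregs M \<subseteq> mregs ?U" "inr ` mregs N \<subseteq> mregs ?U"
    by (auto simp: union_machine_def)
  have "mnext ?U n a G \<in> mstates ?U \<and> (\<forall>k\<in>mregs ?U. mupd ?U n a G k \<subseteq> insert In (Reg ` mregs ?U))"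
    if U: "n \<in> mstates ?U" for n a G
  proof (intro conjI ballI)
    obtain p q where n: "n = prod_encode (p, q)" "p \<in> mstates M" "q \<in> mstates N"
      using U by (auto simp: union_machine_def)
    then show "mnext ?U n a G \<in> mstates ?U"
      by (simp add: union_machine_def M' N')
    fix k assume "k \<in> mregs ?U"
    then consider r where "k = inl r" "r \<in> mregs M" | r where "k = inr r" "r \<in> mregs N"
      by (auto simp: union_machine_def)
    then show "mupd ?U n a G k \<subseteq> insert In (Reg ` mregs ?U)"
    proof cases
      case 1
      then show ?thesis
        using map_source_image_subset[OF M'(2) regs(1)] n by (simp add: union_machine_def)
    next
      case 2
      then show ?thesis
        using map_source_image_subset[OF N'(2) regs(2)] n by (simp add: union_machine_def)
    qed
  qed
  moreover have "finite (mstates ?U)" "finite (mregs ?U)" "mstart ?U \<in> mstates ?U"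
    using M N by (auto simp: is_machine_def union_machine_def)
  ultimately show ?thesis unfolding is_machine_def by blast
qed

text \<open>Simulation relation between the two components and the product. Contents are compared on
  registers only, since \<open>mstep\<close> reads nothing else.\<close>

definition paired :: "(nat, nat, 'a) machine \<Rightarrow> (nat, nat, 'a) machine \<Rightarrow>
    (nat, nat, 'd) config \<Rightarrow> (nat, nat, 'd) config \<Rightarrow> (nat, nat, 'd) config \<Rightarrow> bool" where
  "paired M N c1 c2 c \<longleftrightarrow> fst c = prod_encode (fst c1, fst c2) \<and>
     (\<forall>r\<in>mregs M. snd c (inl r) = snd c1 r) \<and> (\<forall>r\<in>mregs N. snd c (inr r) = snd c2 r)"

lemma paired_mstep:
  assumes "paired M N c1 c2 c"
  shows "paired M N (mstep M c1 x) (mstep N c2 x) (mstep (union_machine M N) c x)"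
proof -
  obtain p f q g h a d where c: "c1 = (p, f)" "c2 = (q, g)" "c = (prod_encode (p, q), h)" "x = (a, d)"
    using assms by (cases c1; cases c2; cases c; cases x) (auto simp: paired_def)
  have f: "h (inl r) = f r" if "r \<in> mregs M" for r using assms that by (auto simp: paired_def c)
  have g: "h (inr r) = g r" if "r \<in> mregs N" for r using assms that by (auto simp: paired_def c)
  have mem: "inl r \<in> sum_encode ` (mregs M <+> mregs N) \<longleftrightarrow> r \<in> mregs M"
    "inr r \<in> sum_encode ` (mregs M <+> mregs N) \<longleftrightarrow> r \<in> mregs N" for r
    by (auto simp: sum_encode_eq)
  \<comment> \<open>The pattern seen by the product, pulled back along each tag, is the pattern that
    the component sees.\<close>
  have G: "{r \<in> mregs M. inl r \<in> {k \<in> sum_encode ` (mregs M <+> mregs N). d \<in> h k}} = {r \<in> mregs M. d \<in> f r}"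
    "{r \<in> mregs N. inr r \<in> {k \<in> sum_encode ` (mregs M <+> mregs N). d \<in> h k}} = {r \<in> mregs N. d \<in> g r}"
    using f g by (auto simp: mem)
  \<comment> \<open>A renamed update mentions registers with its own tag only, so the union over all
    product registers shrinks to one over the component's registers.\<close>
  have left: "{h k |k. k \<in> sum_encode ` (mregs M <+> mregs N) \<and> (\<exists>r. k = inl r \<and> Reg r \<in> U)}
     = {f r |r. r \<in> mregs M \<and> Reg r \<in> U}" for U
    using f mem by (safe; metis)
  have right: "{h k |k. k \<in> sum_encode ` (mregs M <+> mregs N) \<and> (\<exists>r. k = inr r \<and> Reg r \<in> U)}
     = {g r |r. r \<in> mregs N \<and> Reg r \<in> U}" for U
    using g mem by (safe; metis)
  show ?thesis
    unfolding c paired_def mstep_def Let_def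
    by (simp add: union_machine_def G mem left right del: mem_Collect_eq)
qed

lemma paired_mrun: "paired M N (mrun M w) (mrun N w) (mrun (union_machine M N) w)"
proof (induction w rule: rev_induct)
  case Nil
  show ?case by (auto simp: mrun_def paired_def union_machine_def)
next
  case (snoc x w)
  then show ?case unfolding mrun_def foldl_append foldl.simps by (rule paired_mstep)
qed

lemma machine_languages_Un:
  fixes L1 L2 :: "('a \<times> 'd) list set"
  assumes "L1 \<in> machine_languages" "L2 \<in> machine_languages"
  shows "L1 \<union> L2 \<in> machine_languages"
proof -
  obtain M N :: "(nat, nat, 'a) machine" where M: "is_machine M" "L1 = machine_language M"
    and N: "is_machine N" "L2 = machine_language N"
    using assms unfolding machine_languages_def by blast
  have "prod_encode (p, q) \<in> macc (union_machine M N) \<longleftrightarrow> p \<in> macc M \<or> q \<in> macc N" for p q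
    by (simp add: union_machine_def)
  moreover have "fst (mrun (union_machine M N) w) = prod_encode (fst (mrun M w), fst (mrun N w))"
    for w :: "('a \<times> 'd) list"
    using paired_mrun[of M N w] by (simp add: paired_def)
  ultimately have "machine_language (union_machine M N) = L1 \<union> L2"
    by (auto simp: machine_language_def M N)
  then show ?thesis
    using is_machine_union_machine[OF M(1) N(1)] unfolding machine_languages_def by blast
qed

lemma machine_languages_UN:
  assumes "finite I" "\<And>i. i \<in> I \<Longrightarrow> L i \<in> machine_languages"
  shows "(\<Union>i\<in>I. L i) \<in> machine_languages"
  using assms by (induction I) (auto intro: machine_languages_empty machine_languages_Un)

section \<open>From machines to deterministic automata\<close>

text \<open>Every register is tested, so for \<open>G\<close> within the registers the guard accepts
  exactly one membership pattern. The update is restricted because \<open>is_transition\<close>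
  demands an extensional function.\<close>

definition machine_transition ::
  "('q, 'r, 'a) machine \<Rightarrow> 'q \<Rightarrow> 'a \<Rightarrow> 'r set \<Rightarrow> ('q, 'r, 'a) transition" where
  "machine_transition M q a G = \<lparr>src = q, lab = a, gin = G, gnin = mregs M - G,
     upd = (\<lambda>r\<in>mregs M. mupd M q a G r), tgt = mnext M q a G\<rparr>"

definition rsa_of_machine :: "('q, 'r, 'a) machine \<Rightarrow> ('q, 'r, 'a) rsa" where
  "rsa_of_machine M = \<lparr>states = mstates M, regs = mregs M,
     trans = {machine_transition M q a G | q a G. q \<in> mstates M \<and> G \<subseteq> mregs M},
     init = {mstart M}, final = macc M \<inter> mstates M\<rparr>"

lemma machine_transition_sel [simp]:
  "src (machine_transition M q a G) = q"
  "lab (machine_transition M q a G) = a"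
  "gin (machine_transition M q a G) = G"
  "gnin (machine_transition M q a G) = mregs M - G"
  "upd (machine_transition M q a G) = (\<lambda>r\<in>mregs M. mupd M q a G r)"
  "tgt (machine_transition M q a G) = mnext M q a G"
  by (simp_all add: machine_transition_def)

lemma rsa_of_machine_sel [simp]:
  "states (rsa_of_machine M) = mstates M"
  "regs (rsa_of_machine M) = mregs M"
  "trans (rsa_of_machine M) = {machine_transition M q a G | q a G. q \<in> mstates M \<and> G \<subseteq> mregs M}"
  "init (rsa_of_machine M) = {mstart M}"
  "final (rsa_of_machine M) = macc M \<inter> mstates M"
  by (simp_all add: rsa_of_machine_def)

lemma is_rsa_rsa_of_machine:
  assumes "is_machine M"
  shows "is_rsa (rsa_of_machine M)"
proof -
  have "is_transition (rsa_of_machine M) (machine_transition M q a G)"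
    if "q \<in> mstates M" "G \<subseteq> mregs M" for q a G
    using that assms by (simp add: is_transition_def is_machine_def restrict_PiE_iff)
  then show ?thesis
    using assms unfolding is_rsa_def is_machine_def by auto
qed

text \<open>If two guards do not conflict, each positive set is contained in the other. The sets
  then agree, and with source and label they fix the transition.\<close>

lemma deterministic_rsa_of_machine: "deterministic (rsa_of_machine M)"
proof -
  have "G = G'" if "G \<subseteq> mregs M" "G' \<subseteq> mregs M" "G \<inter> (mregs M - G') = {}" "G' \<inter> (mregs M - G) = {}"
    for G G'
    using that by blast
  then show ?thesis unfolding deterministic_def by clarsimp blast
qed

text \<open>The guard for \<open>G\<close> holds precisely when \<open>G\<close> is the set of
  registers containing the datum, so exactly one transition is enabled.\<close>

lemma step_rsa_of_machine:
  assumes "fst c \<in> mstates M"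
  shows "step (rsa_of_machine M) x c c' \<longleftrightarrow> c' = mstep M c x"
proof -
  obtain q f a d q' f' where c: "c = (q, f)" "x = (a, d)" "c' = (q', f')"
    by (cases c; cases x; cases c')
  let ?t = "machine_transition M q a" and ?G = "{r \<in> mregs M. d \<in> f r}"
  have enabled: "enabled (?t G) f d \<longleftrightarrow> G = ?G" if "G \<subseteq> mregs M" for G
    using that by (auto simp: enabled_def)
  \<comment> \<open>The hypothesis on \<open>c\<close> enters here: transitions exist only from
    states in \<open>mstates M\<close>, and with source and label fixed they are indexed by
    \<open>G\<close>.\<close>
  have trans: "t \<in> trans (rsa_of_machine M) \<and> src t = q \<and> lab t = a \<longleftrightarrow> (\<exists>G\<subseteq>mregs M. t = ?t G)" for t
    using assms by (auto simp: c)
  have "step (rsa_of_machine M) x c c' \<longleftrightarrow>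
      (\<exists>t. (t \<in> trans (rsa_of_machine M) \<and> src t = q \<and> lab t = a) \<and>
        tgt t = q' \<and> enabled t f d \<and> f' = update (rsa_of_machine M) t f d)"
    unfolding c step_def prod.case by blast
  also have "\<dots> \<longleftrightarrow> (\<exists>G\<subseteq>mregs M. tgt (?t G) = q' \<and> enabled (?t G) f d \<and>
      f' = update (rsa_of_machine M) (?t G) f d)"
    unfolding trans by blast
  also have "\<dots> \<longleftrightarrow> q' = mnext M q a ?G \<and> f' = update (rsa_of_machine M) (?t ?G) f d"
    (is "?L \<longleftrightarrow> ?R")
  proof
    assume ?L
    then obtain G where "G \<subseteq> mregs M" "tgt (?t G) = q'" "enabled (?t G) f d"
      "f' = update (rsa_of_machine M) (?t G) f d" by blast
    moreover from this have "G = ?G" using enabled by blast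
    ultimately show ?R by simp
  next
    assume ?R
    moreover have "?G \<subseteq> mregs M" by blast
    ultimately show ?L using enabled by (intro exI[of _ ?G]) simp
  qed
  also have "\<dots> \<longleftrightarrow> c' = mstep M c x"
    by (simp add: c mstep_def Let_def update_def cong: restrict_cong)
  finally show ?thesis .
qed

lemma run_rsa_of_machine:
  assumes "is_machine M" "fst c \<in> mstates M"
  shows "run (rsa_of_machine M) c w c' \<longleftrightarrow> c' = foldl (mstep M) c w"
  using assms(2)
  by (induction w arbitrary: c)
    (simp_all add: run_Nil_iff run_Cons_iff step_rsa_of_machine mstep_in_states[OF assms(1)]
      del: split_paired_Ex rsa_of_machine_sel)

lemma language_rsa_of_machine:
  fixes M :: "('q, 'r, 'a) machine"
  assumes "is_machine M"
  shows "language (rsa_of_machine M) = machine_language M"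
proof -
  have start: "mstart M \<in> mstates M" using assms by (simp add: is_machine_def)
  \<comment> \<open>Reached states lie in \<open>mstates M\<close>, so cutting the final states down
    to that set loses no accepted word.\<close>
  have in_states: "fst (mrun M w) \<in> mstates M" for w :: "('a \<times> 'd) list"
    by (induction w rule: rev_induct) (auto simp: mrun_def start mstep_in_states[OF assms])
  have "w \<in> language (rsa_of_machine M) \<longleftrightarrow> fst (mrun M w) \<in> macc M \<inter> mstates M"
    for w :: "('a \<times> 'd) list"
  proof -
    have "run (rsa_of_machine M) (mstart M, \<lambda>r\<in>mregs M. {}) w c \<longleftrightarrow> c = mrun M w" for c
      using start by (simp add: mrun_def run_rsa_of_machine[OF assms])
    then have "w \<in> language (rsa_of_machine M) \<longleftrightarrow>
        (\<exists>q f. (q, f) = mrun M w \<and> q \<in> macc M \<inter> mstates M)"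
      by (simp add: language_def initial_config_def)
    then show ?thesis by (cases "mrun M w") simp
  qed
  then show ?thesis
    using in_states by (auto simp: machine_language_def)
qed

lemma machine_languages_subset_drsa_languages: "machine_languages \<subseteq> drsa_languages"
  unfolding machine_languages_def drsa_languages_def
  using is_rsa_rsa_of_machine deterministic_rsa_of_machine language_rsa_of_machine by blast

section \<open>From deterministic automata to machines\<close>

text \<open>Enabledness phrased without the datum: \<open>G\<close> stands for the set of registers
  that contain it.\<close>

definition compatible ::
  "('q, 'r, 'a) rsa \<Rightarrow> 'q \<Rightarrow> 'a \<Rightarrow> 'r set \<Rightarrow> ('q, 'r, 'a) transition \<Rightarrow> bool" where
  "compatible A q a G t \<longleftrightarrow> t \<in> trans A \<and> src t = q \<and> lab t = a \<and> gin t \<subseteq> G \<and> gnin t \<inter> G = {}"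

definition chosen ::
  "('q, 'r, 'a) rsa \<Rightarrow> 'q \<Rightarrow> 'a \<Rightarrow> 'r set \<Rightarrow> ('q, 'r, 'a) transition option" where
  "chosen A q a G = (if \<exists>t. compatible A q a G t then Some (SOME t. compatible A q a G t) else None)"

text \<open>A register in the positive guard of one compatible transition and the negative guard of
  another would lie both inside and outside \<open>G\<close>. Determinism therefore makes the two
  equal, and the choice is forced.\<close>

lemma chosen_eq_Some_iff:
  assumes "deterministic A" "q \<in> states A"
  shows "chosen A q a G = Some t \<longleftrightarrow> compatible A q a G t"
proof -
  have "t = t'" if "compatible A q a G t" "compatible A q a G t'" for t t'
    using that assms unfolding compatible_def deterministic_def by blast
  then show ?thesis unfolding chosen_def by (auto intro: someI)
qed

text \<open>State \<open>0\<close> is the rejecting sink, and \<open>Suc q\<close> stands for the state \<open>q\<close> of \<open>A\<close>.\<close>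

definition machine_of_rsa :: "(nat, 'r, 'a) rsa \<Rightarrow> nat \<Rightarrow> (nat, 'r, 'a) machine" where
  "machine_of_rsa A q0 = \<lparr>mstates = insert 0 (Suc ` states A), mregs = regs A, mstart = Suc q0,
     macc = Suc ` final A,
     mnext = \<lambda>n a G. case n of 0 \<Rightarrow> 0 | Suc q \<Rightarrow>
       (case chosen A q a G of None \<Rightarrow> 0 | Some t \<Rightarrow> Suc (tgt t)),
     mupd = \<lambda>n a G r. case n of 0 \<Rightarrow> {} | Suc q \<Rightarrow>
       (case chosen A q a G of None \<Rightarrow> {} | Some t \<Rightarrow> upd t r)\<rparr>"

lemma is_machine_machine_of_rsa:
  assumes "is_rsa A" "deterministic A" "q0 \<in> states A"
  shows "is_machine (machine_of_rsa A q0)"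
proof -
  have "is_transition A t" if "chosen A q a G = Some t" "q \<in> states A" for q a G t
    using that assms by (simp add: chosen_eq_Some_iff compatible_def is_rsa_def)
  then have "tgt t \<in> states A \<and> (\<forall>r\<in>regs A. upd t r \<subseteq> insert In (Reg ` regs A))"
    if "chosen A q a G = Some t" "q \<in> states A" for q a G t
    using that unfolding is_transition_def by blast
  then show ?thesis
    using assms unfolding is_machine_def machine_of_rsa_def is_rsa_def
    by (auto split: option.split)
qed

text \<open>Once \<open>A\<close> is stuck, every continuation must be rejected: \<open>0\<close> is
  absorbing, while accepting states are successors.\<close>

lemma fst_foldl_mstep_sink:
  assumes "fst c = 0"
  shows "fst (foldl (mstep (machine_of_rsa A q0)) c w) = 0"
  using assms
proof (induction w arbitrary: c)
  case (Cons x w)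
  have "fst (mstep (machine_of_rsa A q0) c x) = 0"
    using Cons.prems by (cases c; cases x) (simp add: mstep_def machine_of_rsa_def Let_def)
  then show ?case by (simp add: Cons.IH)
qed simp

text \<open>A target \<open>Suc q'\<close> excludes the sink, so such a machine step comes from the
  chosen transition, which is the only one that \<open>A\<close> can fire.\<close>

lemma step_machine_of_rsa:
  assumes "is_rsa A" "deterministic A" "q \<in> states A"
  shows "step A x (q, f) (q', f') \<longleftrightarrow> mstep (machine_of_rsa A q0) (Suc q, f) x = (Suc q', f')"
proof -
  obtain a d where x: "x = (a, d)" by (cases x)
  let ?G = "{r \<in> regs A. d \<in> f r}"
  \<comment> \<open>Guards mention registers of \<open>A\<close> only, so the set \<open>?G\<close>
    decides them.\<close>
  have enabled: "enabled t f d \<longleftrightarrow> gin t \<subseteq> ?G \<and> gnin t \<inter> ?G = {}" if "t \<in> trans A" for t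
  proof -
    have "gin t \<subseteq> regs A" "gnin t \<subseteq> regs A"
      using that assms(1) by (auto simp: is_rsa_def is_transition_def)
    then show ?thesis unfolding enabled_def by auto
  qed
  have compatible: "compatible A q a ?G t \<longleftrightarrow>
      t \<in> trans A \<and> src t = q \<and> lab t = a \<and> enabled t f d" for t
    using enabled by (auto simp: compatible_def)
  have "step A x (q, f) (q', f') \<longleftrightarrow>
      (\<exists>t. compatible A q a ?G t \<and> tgt t = q' \<and> f' = update A t f d)"
    unfolding x step_def compatible prod.case by blast
  also have "\<dots> \<longleftrightarrow> (\<exists>t. chosen A q a ?G = Some t \<and> tgt t = q' \<and> f' = update A t f d)"
    by (simp only: chosen_eq_Some_iff[OF assms(2,3)])
  also have "\<dots> \<longleftrightarrow> mstep (machine_of_rsa A q0) (Suc q, f) x = (Suc q', f')"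
    by (cases "chosen A q a ?G") (auto simp: x mstep_def machine_of_rsa_def update_def)
  finally show ?thesis .
qed

lemma run_machine_of_rsa:
  assumes "is_rsa A" "deterministic A" "q \<in> states A"
  shows "run A (q, f) w (q', f') \<longleftrightarrow> foldl (mstep (machine_of_rsa A q0)) (Suc q, f) w = (Suc q', f')"
  using assms(3)
proof (induction w arbitrary: q f)
  case Nil
  then show ?case by (auto simp: run_Nil_iff)
next
  case (Cons x w)
  obtain n g where c: "mstep (machine_of_rsa A q0) (Suc q, f) x = (n, g)" by fastforce
  have step: "step A x (q, f) (p, h) \<longleftrightarrow> n = Suc p \<and> g = h" for p h
    using step_machine_of_rsa[OF assms(1,2) Cons.prems, of x f p h q0] by (simp add: c)
  show ?case
  proof (cases n)
    \<comment> \<open>Here \<open>A\<close> has no step on \<open>x\<close> and the machine never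
      leaves the sink, so both sides are false.\<close>
    case 0
    then show ?thesis
      using step fst_foldl_mstep_sink[of "(0, g)" A q0 w] by (auto simp: run_Cons_iff c)
  next
    case (Suc p)
    then have "step A x (q, f) (p, g)" using step by simp
    \<comment> \<open>Membership in \<open>states A\<close> is what the induction hypothesis asks of
      the successor.\<close>
    then have "p \<in> states A"
      using assms(1) by (cases x) (auto simp: step_def is_rsa_def is_transition_def)
    then show ?thesis using step Suc by (auto simp: run_Cons_iff c Cons.IH)
  qed
qed

text \<open>Determinism does not bound the number of initial states. Splitting runs by the state in
  which they begin leaves one machine for each.\<close>

lemma language_eq_UN_machine_language:
  fixes A :: "(nat, 'r, 'a) rsa"
  assumes "is_rsa A" "deterministic A"
  shows "(language A :: ('a \<times> 'd) list set) = (\<Union>q\<in>init A. machine_language (machine_of_rsa A q))"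
proof -
  let ?f = "\<lambda>r\<in>regs A. {}"
  have "(\<exists>q' f'. run A (q, ?f) w (q', f') \<and> q' \<in> final A) \<longleftrightarrow>
      w \<in> machine_language (machine_of_rsa A q)" if "q \<in> init A" for q and w :: "('a \<times> 'd) list"
  proof -
    have q: "q \<in> states A" using that assms(1) by (auto simp: is_rsa_def)
    have "run A (q, ?f) w (q', f') \<longleftrightarrow> mrun (machine_of_rsa A q) w = (Suc q', f')" for q' f'
      unfolding run_machine_of_rsa[OF assms q, of _ _ _ _ q] mrun_def
      by (simp add: machine_of_rsa_def)
    moreover have "macc (machine_of_rsa A q) = Suc ` final A"
      by (simp add: machine_of_rsa_def)
    ultimately show ?thesis
      unfolding machine_language_def by (cases "mrun (machine_of_rsa A q) w") auto
  qed
  moreover have "(language A :: ('a \<times> 'd) list set) =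
      {w. \<exists>q\<in>init A. \<exists>q' f'. run A (q, ?f) w (q', f') \<and> q' \<in> final A}"
    unfolding language_def initial_config_def by blast
  ultimately show ?thesis by auto
qed

section \<open>Equality of the two classes and the closure properties\<close>

lemma drsa_languages_eq_machine_languages: "drsa_languages = machine_languages"
proof
  show "drsa_languages \<subseteq> (machine_languages :: ('a \<times> 'd) list set set)"
  proof
    fix L :: "('a \<times> 'd) list set"
    assume "L \<in> drsa_languages"
    then obtain A :: "(nat, nat, 'a) rsa" where A: "is_rsa A" "deterministic A" "L = language A"
      unfolding drsa_languages_def by blast
    \<comment> \<open>Finiteness of the state set makes the union over initial states a finite
      one.\<close>
    then have I: "init A \<subseteq> states A" "finite (init A)"
      by (auto simp: is_rsa_def intro: finite_subset)
    have "machine_language (machine_of_rsa A q) \<in> machine_languages" if "q \<in> init A" for q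
      using is_machine_machine_of_rsa[OF A(1,2)] that I unfolding machine_languages_def by blast
    then show "L \<in> machine_languages"
      unfolding A(3) language_eq_UN_machine_language[OF A(1,2)]
      by (rule machine_languages_UN[OF I(2)])
  qed
qed (rule machine_languages_subset_drsa_languages)

theorem theorem4p5:
  assumes "infinite (UNIV :: 'd set)"
  shows "(\<forall>L1 \<in> drsa_languages. \<forall>L2 \<in> drsa_languages.
            L1 \<union> L2 \<in> (drsa_languages :: ('a::finite \<times> 'd) list set set)) \<and>
         (\<forall>L1 \<in> drsa_languages. \<forall>L2 \<in> drsa_languages.
            L1 \<inter> L2 \<in> (drsa_languages :: ('a::finite \<times> 'd) list set set)) \<and>
         (\<forall>L \<in> drsa_languages.
            - L \<in> (drsa_languages :: ('a::finite \<times> 'd) list set set))"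
proof -
  \<comment> \<open>De Morgan: the intersection is the complement of the union of the
    complements.\<close>
  have "L1 \<inter> L2 \<in> machine_languages"
    if "L1 \<in> machine_languages" "L2 \<in> machine_languages" for L1 L2 :: "('a \<times> 'd) list set"
    using machine_languages_Compl[OF machine_languages_Un[OF that[THEN machine_languages_Compl]]]
    by simp
  then show ?thesis
    unfolding drsa_languages_eq_machine_languages
    by (intro conjI ballI machine_languages_Un machine_languages_Compl)
qed

end
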